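(* Let $R$ be a ring with identity, let $M$ be a unitary $R$-bimodule, and let $T(R,M)$ be the trivial extension of $R$ by $M$, regarded as a superring. Let $d_0$ and $d_1$ be, respectively, Jordan superderivations of degree $0$ and degree $1$ of $T(R,M)$. Then there exist (i) a Jordan derivation $\delta: R\to R$; (ii) a Jordan derivation $\gamma: R\to M$; (iii) a Jordan $R$-homomorphism $f: M\to R$ satisfying $m\circ f(m')=f(m)\circ m'$ for all $m,m'\in M$; (iv) an additive mapping $g: M\to M$ satisfying $g(r\circ m)=r\circ g(m)+\delta(r)\circ m$ for all $r\in R$, $m\in M$; such that for all $r\in R$, $m\in M$, $$d_0(r,m)=(\delta(r),g(m))\quad\text{and}\quad d_1(r,m)=(f(m),\gamma(r)).$$ Hence every Jordan superderivation $d$ of $T(R,M)$ is of the form $$d(r,m)=(\delta(r)+f(m),\,g(m)+\gamma(r))$$ with $\delta,\gamma,f,g$ as in (i)-(iv).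
   Context: All rings are unital. For an $R$-bimodule $M$, $r\in R$, $m\in M$, the Jordan product is $r\circ m=m\circ r=rm+mr$; in a ring, $x\circ y=xy+yx$. An additive map $d:R\to M$ ($M$ an $R$-bimodule, possibly $M=R$) is a Jordan derivation if $d(a\circ b)=d(a)\circ b+a\circ d(b)$ for all $a,b\in R$. For $R$-bimodules $M,N$, an additive map $\varphi:M\to N$ is a Jordan $R$-homomorphism (also called bimodule Jordan homomorphism) if $\varphi(r\circ m)=r\circ\varphi(m)$ for all $r\in R$, $m\in M$. A superring is a ring $A$ with identity with additive subgroups $A_0,A_1$ such that $A=A_0\oplus A_1$ and $A_iA_j\subseteq A_{i+j}$ (indices modulo 2). For $a\in A_i$ write $|a|=i$. For $x,y\in A_0\cup A_1$ the Jordan superproduct is $x\circ_s y=xy+(-1)^{|x||y|}yx$. For $i\in\{0,1\}$, a Jordan superderivation of degree $i$ of $A$ is an additive map $d_i:A\to A$ with $d_i(A_j)\subseteq A_{i+j}$ (indices modulo 2) and $d_i(x\circ_s y)=d_i(x)\circ_s y+(-1)^{i|x|}x\circ_s d_i(y)$ for all $x,y\in A_0\cup A_1$. A Jordan superderivation of $A$ is the sum of a Jordan superderivation of degree $0$ and one of degree $1$. The trivial extension $T(R,M)=\{(r,m): r\in R, m\in M\}$ has componentwise addition and multiplication $(r,m)(r',m')=(rr',rm'+mr')$, with identity $(1,0)$. It is a superring with $A_0=\{(r,0):r\in R\}$ and $A_1=\{(0,m):m\in M\}$. *)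

theory Defs
  imports "HOL-Algebra.AbelCoset"
begin

section \<open>Bimodules and Jordan maps\<close>

text \<open>As for the library's \<open>module\<close> record, the multiplicative fields inherited from \<open>ring\<close>
  carry no meaning for a bimodule.\<close>

record ('a, 'b) bimodule = "'b ring" +
  lact :: "['a, 'b] \<Rightarrow> 'b" (infixl \<open>\<triangleright>\<index>\<close> 70)
  ract :: "['b, 'a] \<Rightarrow> 'b" (infixl \<open>\<triangleleft>\<index>\<close> 70)

locale bimodule = R?: ring R + M?: abelian_group M
  for R :: "('a, 'c) ring_scheme" (structure)
    and M :: "('a, 'b, 'd) bimodule_scheme" (structure) +
  assumes lact_closed [intro, simp]:
      "\<lbrakk>r \<in> carrier R; m \<in> carrier M\<rbrakk> \<Longrightarrow> r \<triangleright>\<^bsub>M\<^esub> m \<in> carrier M"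
    and ract_closed [intro, simp]:
      "\<lbrakk>r \<in> carrier R; m \<in> carrier M\<rbrakk> \<Longrightarrow> m \<triangleleft>\<^bsub>M\<^esub> r \<in> carrier M"
    and lact_l_distr:
      "\<lbrakk>r \<in> carrier R; s \<in> carrier R; m \<in> carrier M\<rbrakk>
        \<Longrightarrow> (r \<oplus>\<^bsub>R\<^esub> s) \<triangleright>\<^bsub>M\<^esub> m = r \<triangleright>\<^bsub>M\<^esub> m \<oplus>\<^bsub>M\<^esub> s \<triangleright>\<^bsub>M\<^esub> m"
    and lact_r_distr:
      "\<lbrakk>r \<in> carrier R; m \<in> carrier M; n \<in> carrier M\<rbrakk>
        \<Longrightarrow> r \<triangleright>\<^bsub>M\<^esub> (m \<oplus>\<^bsub>M\<^esub> n) = r \<triangleright>\<^bsub>M\<^esub> m \<oplus>\<^bsub>M\<^esub> r \<triangleright>\<^bsub>M\<^esub> n"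
    and ract_l_distr:
      "\<lbrakk>r \<in> carrier R; m \<in> carrier M; n \<in> carrier M\<rbrakk>
        \<Longrightarrow> (m \<oplus>\<^bsub>M\<^esub> n) \<triangleleft>\<^bsub>M\<^esub> r = m \<triangleleft>\<^bsub>M\<^esub> r \<oplus>\<^bsub>M\<^esub> n \<triangleleft>\<^bsub>M\<^esub> r"
    and ract_r_distr:
      "\<lbrakk>r \<in> carrier R; s \<in> carrier R; m \<in> carrier M\<rbrakk>
        \<Longrightarrow> m \<triangleleft>\<^bsub>M\<^esub> (r \<oplus>\<^bsub>R\<^esub> s) = m \<triangleleft>\<^bsub>M\<^esub> r \<oplus>\<^bsub>M\<^esub> m \<triangleleft>\<^bsub>M\<^esub> s"
    and lact_assoc:
      "\<lbrakk>r \<in> carrier R; s \<in> carrier R; m \<in> carrier M\<rbrakk>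
        \<Longrightarrow> (r \<otimes>\<^bsub>R\<^esub> s) \<triangleright>\<^bsub>M\<^esub> m = r \<triangleright>\<^bsub>M\<^esub> (s \<triangleright>\<^bsub>M\<^esub> m)"
    and ract_assoc:
      "\<lbrakk>r \<in> carrier R; s \<in> carrier R; m \<in> carrier M\<rbrakk>
        \<Longrightarrow> m \<triangleleft>\<^bsub>M\<^esub> (r \<otimes>\<^bsub>R\<^esub> s) = (m \<triangleleft>\<^bsub>M\<^esub> r) \<triangleleft>\<^bsub>M\<^esub> s"
    and lact_ract_assoc:
      "\<lbrakk>r \<in> carrier R; s \<in> carrier R; m \<in> carrier M\<rbrakk>
        \<Longrightarrow> (r \<triangleright>\<^bsub>M\<^esub> m) \<triangleleft>\<^bsub>M\<^esub> s = r \<triangleright>\<^bsub>M\<^esub> (m \<triangleleft>\<^bsub>M\<^esub> s)"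
    and lact_one [simp]: "m \<in> carrier M \<Longrightarrow> \<one>\<^bsub>R\<^esub> \<triangleright>\<^bsub>M\<^esub> m = m"
    and ract_one [simp]: "m \<in> carrier M \<Longrightarrow> m \<triangleleft>\<^bsub>M\<^esub> \<one>\<^bsub>R\<^esub> = m"

definition regular_bimodule :: "('a, 'c) ring_scheme \<Rightarrow> ('a, 'a) bimodule" where
  "regular_bimodule R = \<lparr>carrier = carrier R, mult = mult R, one = \<one>\<^bsub>R\<^esub>,
     zero = \<zero>\<^bsub>R\<^esub>, add = add R, lact = mult R, ract = mult R\<rparr>"

definition additive_map ::
  "('a, 'c) ring_scheme \<Rightarrow> ('b, 'd) ring_scheme \<Rightarrow> ('a \<Rightarrow> 'b) \<Rightarrow> bool" where
  "additive_map A B h \<longleftrightarrow> h \<in> hom (add_monoid A) (add_monoid B)"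

definition jordan_prod :: "('a, 'c) ring_scheme \<Rightarrow> 'a \<Rightarrow> 'a \<Rightarrow> 'a" where
  "jordan_prod R x y = x \<otimes>\<^bsub>R\<^esub> y \<oplus>\<^bsub>R\<^esub> y \<otimes>\<^bsub>R\<^esub> x"

text \<open>The product \<open>r \<circ> m = m \<circ> r\<close> of a scalar and a bimodule element; both orders are
  rendered with the scalar first.\<close>

definition jordan_act :: "('a, 'b, 'd) bimodule_scheme \<Rightarrow> 'a \<Rightarrow> 'b \<Rightarrow> 'b" where
  "jordan_act M r m = r \<triangleright>\<^bsub>M\<^esub> m \<oplus>\<^bsub>M\<^esub> m \<triangleleft>\<^bsub>M\<^esub> r"

definition jordan_derivation ::
  "('a, 'c) ring_scheme \<Rightarrow> ('a, 'b, 'd) bimodule_scheme \<Rightarrow> ('a \<Rightarrow> 'b) \<Rightarrow> bool" where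
  "jordan_derivation R M d \<longleftrightarrow> additive_map R M d \<and>
     (\<forall>a\<in>carrier R. \<forall>b\<in>carrier R.
        d (jordan_prod R a b) = jordan_act M b (d a) \<oplus>\<^bsub>M\<^esub> jordan_act M a (d b))"

definition jordan_bimodule_hom ::
  "('a, 'c) ring_scheme \<Rightarrow> ('a, 'b, 'd) bimodule_scheme \<Rightarrow> ('a, 'e, 'f) bimodule_scheme
    \<Rightarrow> ('b \<Rightarrow> 'e) \<Rightarrow> bool" where
  "jordan_bimodule_hom R M N \<phi> \<longleftrightarrow> additive_map M N \<phi> \<and>
     (\<forall>r\<in>carrier R. \<forall>m\<in>carrier M. \<phi> (jordan_act M r m) = jordan_act N r (\<phi> m))"


section \<open>Superrings and Jordan superderivations\<close>

text \<open>A grading is a function \<open>G\<close> of which only the values \<open>G 0\<close> and \<open>G 1\<close> matter.\<close>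

locale superring = ring A for A :: "('a, 'c) ring_scheme" (structure) +
  fixes G :: "nat \<Rightarrow> 'a set"
  assumes additive_subgroup_0: "additive_subgroup (G 0) A"
    and additive_subgroup_1: "additive_subgroup (G 1) A"
    and sum_eq_carrier: "set_add A (G 0) (G 1) = carrier A"
    and Int_eq_zero: "G 0 \<inter> G 1 = {\<zero>}"
    and mult_graded:
      "\<lbrakk>i \<in> {0, 1}; j \<in> {0, 1}; x \<in> G i; y \<in> G j\<rbrakk> \<Longrightarrow> x \<otimes> y \<in> G ((i + j) mod 2)"

text \<open>The degree of a homogeneous element. Zero lies in both components and gets degree 0; this
  choice is immaterial, as every term in which the degree of zero occurs vanishes.\<close>

definition parity :: "(nat \<Rightarrow> 'a set) \<Rightarrow> 'a \<Rightarrow> nat" where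
  "parity G x = (if x \<in> G 0 then 0 else 1)"

definition jordan_superprod ::
  "('a, 'c) ring_scheme \<Rightarrow> (nat \<Rightarrow> 'a set) \<Rightarrow> 'a \<Rightarrow> 'a \<Rightarrow> 'a" where
  "jordan_superprod A G x y =
     x \<otimes>\<^bsub>A\<^esub> y \<oplus>\<^bsub>A\<^esub> [((-1) ^ (parity G x * parity G y) :: int)] \<cdot>\<^bsub>A\<^esub> (y \<otimes>\<^bsub>A\<^esub> x)"

definition jordan_superderivation_of_degree ::
  "('a, 'c) ring_scheme \<Rightarrow> (nat \<Rightarrow> 'a set) \<Rightarrow> nat \<Rightarrow> ('a \<Rightarrow> 'a) \<Rightarrow> bool" where
  "jordan_superderivation_of_degree A G i d \<longleftrightarrow> additive_map A A d \<and>
     (\<forall>j\<in>{0, 1}. d ` G j \<subseteq> G ((i + j) mod 2)) \<and>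
     (\<forall>x\<in>G 0 \<union> G 1. \<forall>y\<in>G 0 \<union> G 1.
        d (jordan_superprod A G x y) =
          jordan_superprod A G (d x) y \<oplus>\<^bsub>A\<^esub>
          [((-1) ^ (i * parity G x) :: int)] \<cdot>\<^bsub>A\<^esub> jordan_superprod A G x (d y))"

definition jordan_superderivation ::
  "('a, 'c) ring_scheme \<Rightarrow> (nat \<Rightarrow> 'a set) \<Rightarrow> ('a \<Rightarrow> 'a) \<Rightarrow> bool" where
  "jordan_superderivation A G d \<longleftrightarrow>
     (\<exists>d\<^sub>0 d\<^sub>1. jordan_superderivation_of_degree A G 0 d\<^sub>0 \<and>
        jordan_superderivation_of_degree A G 1 d\<^sub>1 \<and>
        (\<forall>x\<in>carrier A. d x = d\<^sub>0 x \<oplus>\<^bsub>A\<^esub> d\<^sub>1 x))"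


section \<open>Trivial extensions\<close>

definition trivial_extension ::
  "('a, 'c) ring_scheme \<Rightarrow> ('a, 'b, 'd) bimodule_scheme \<Rightarrow> ('a \<times> 'b) ring" where
  "trivial_extension R M =
     \<lparr>carrier = carrier R \<times> carrier M,
      mult = (\<lambda>(r, m) (r', m'). (r \<otimes>\<^bsub>R\<^esub> r', r \<triangleright>\<^bsub>M\<^esub> m' \<oplus>\<^bsub>M\<^esub> m \<triangleleft>\<^bsub>M\<^esub> r')),
      one = (\<one>\<^bsub>R\<^esub>, \<zero>\<^bsub>M\<^esub>),
      zero = (\<zero>\<^bsub>R\<^esub>, \<zero>\<^bsub>M\<^esub>),
      add = (\<lambda>(r, m) (r', m'). (r \<oplus>\<^bsub>R\<^esub> r', m \<oplus>\<^bsub>M\<^esub> m'))\<rparr>"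

definition trivial_grading ::
  "('a, 'c) ring_scheme \<Rightarrow> ('a, 'b, 'd) bimodule_scheme \<Rightarrow> nat \<Rightarrow> ('a \<times> 'b) set" where
  "trivial_grading R M i =
     (if i = 0 then carrier R \<times> {\<zero>\<^bsub>M\<^esub>} else {\<zero>\<^bsub>R\<^esub>} \<times> carrier M)"

context bimodule
begin

lemma lact_zero [simp]: "r \<in> carrier R \<Longrightarrow> r \<triangleright>\<^bsub>M\<^esub> \<zero>\<^bsub>M\<^esub> = \<zero>\<^bsub>M\<^esub>"
  using lact_r_distr [of r "\<zero>\<^bsub>M\<^esub>" "\<zero>\<^bsub>M\<^esub>"] M.add.r_cancel_one' by fastforce

lemma zero_ract [simp]: "r \<in> carrier R \<Longrightarrow> \<zero>\<^bsub>M\<^esub> \<triangleleft>\<^bsub>M\<^esub> r = \<zero>\<^bsub>M\<^esub>"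
  using ract_l_distr [of r "\<zero>\<^bsub>M\<^esub>" "\<zero>\<^bsub>M\<^esub>"] M.add.r_cancel_one' by fastforce

lemma zero_lact [simp]: "m \<in> carrier M \<Longrightarrow> \<zero>\<^bsub>R\<^esub> \<triangleright>\<^bsub>M\<^esub> m = \<zero>\<^bsub>M\<^esub>"
  using lact_l_distr [of "\<zero>\<^bsub>R\<^esub>" "\<zero>\<^bsub>R\<^esub>" m] M.add.r_cancel_one' by fastforce

lemma ract_zero [simp]: "m \<in> carrier M \<Longrightarrow> m \<triangleleft>\<^bsub>M\<^esub> \<zero>\<^bsub>R\<^esub> = \<zero>\<^bsub>M\<^esub>"
  using ract_r_distr [of "\<zero>\<^bsub>R\<^esub>" "\<zero>\<^bsub>R\<^esub>" m] M.add.r_cancel_one' by fastforce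

lemma bimodule_regular: "bimodule R (regular_bimodule R)"
proof -
  have "abelian_group (regular_bimodule R)"
    by (rule abelian_groupI)
      (auto simp: regular_bimodule_def R.a_ac intro: R.add.l_inv_ex)
  then show ?thesis
    by (intro bimodule.intro bimodule_axioms.intro R.ring_axioms)
      (auto simp: regular_bimodule_def R.l_distr R.r_distr R.m_assoc)
qed

lemma ring_trivial_extension: "ring (trivial_extension R M)"
proof (rule ringI)
  show "abelian_group (trivial_extension R M)"
  proof (rule abelian_groupI)
    fix x assume "x \<in> carrier (trivial_extension R M)"
    then have "(\<ominus>\<^bsub>R\<^esub> fst x, \<ominus>\<^bsub>M\<^esub> snd x) \<in> carrier (trivial_extension R M)"
      "(\<ominus>\<^bsub>R\<^esub> fst x, \<ominus>\<^bsub>M\<^esub> snd x) \<oplus>\<^bsub>trivial_extension R M\<^esub> x = \<zero>\<^bsub>trivial_extension R M\<^esub>"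
      by (auto simp: trivial_extension_def R.l_neg M.l_neg)
    then show "\<exists>y\<in>carrier (trivial_extension R M).
        y \<oplus>\<^bsub>trivial_extension R M\<^esub> x = \<zero>\<^bsub>trivial_extension R M\<^esub>"
      by blast
  qed (auto simp: trivial_extension_def R.a_ac M.a_ac)
  show "monoid (trivial_extension R M)"
    by (rule monoidI)
      (auto simp: trivial_extension_def R.m_assoc lact_assoc ract_assoc lact_ract_assoc
        lact_r_distr ract_l_distr M.a_assoc)
qed (auto simp: trivial_extension_def R.l_distr R.r_distr lact_l_distr lact_r_distr
      ract_l_distr ract_r_distr M.a_ac)

lemma superring_trivial_extension:
  "superring (trivial_extension R M) (trivial_grading R M)"
proof -
  interpret T: ring "trivial_extension R M"
    by (rule ring_trivial_extension)
  have neg: "\<ominus>\<^bsub>trivial_extension R M\<^esub> (r, m) = (\<ominus>\<^bsub>R\<^esub> r, \<ominus>\<^bsub>M\<^esub> m)"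
    if "r \<in> carrier R" "m \<in> carrier M" for r m
    using that
    by (intro T.minus_equality) (auto simp: trivial_extension_def R.l_neg M.l_neg)
  have sub: "additive_subgroup (trivial_grading R M i) (trivial_extension R M)" for i
  proof (rule additive_subgroup.intro, rule T.add.subgroupI)
    show "trivial_grading R M i \<noteq> {}"
      by (auto simp: trivial_grading_def)
    fix x assume "x \<in> trivial_grading R M i"
    then show "\<ominus>\<^bsub>trivial_extension R M\<^esub> x \<in> trivial_grading R M i"
      by (auto simp: trivial_grading_def neg split: if_splits)
  qed (auto simp: trivial_grading_def trivial_extension_def split: if_splits)
  have "set_add (trivial_extension R M) (trivial_grading R M 0) (trivial_grading R M 1)
      = carrier (trivial_extension R M)"
  proof
    show "carrier (trivial_extension R M) \<subseteq>
        set_add (trivial_extension R M) (trivial_grading R M 0) (trivial_grading R M 1)"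
    proof
      fix x assume "x \<in> carrier (trivial_extension R M)"
      then have "x = (fst x, \<zero>\<^bsub>M\<^esub>) \<oplus>\<^bsub>trivial_extension R M\<^esub> (\<zero>\<^bsub>R\<^esub>, snd x)"
        "(fst x, \<zero>\<^bsub>M\<^esub>) \<in> trivial_grading R M 0" "(\<zero>\<^bsub>R\<^esub>, snd x) \<in> trivial_grading R M 1"
        by (auto simp: trivial_extension_def trivial_grading_def)
      then show "x \<in> set_add (trivial_extension R M)
          (trivial_grading R M 0) (trivial_grading R M 1)"
        unfolding set_add_def' by blast
    qed
  qed (auto simp: set_add_def' trivial_extension_def trivial_grading_def)
  then show ?thesis
    by (intro superring.intro superring_axioms.intro T.ring_axioms sub)
      (auto simp: trivial_extension_def trivial_grading_def split: if_splits)
qed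

end

end

theory Submission
  imports Defs
begin

text \<open>The components of \<open>T(R,M)\<close> are copies of \<open>R\<close> (even) and \<open>M\<close> (odd), and the superproduct of
  homogeneous elements reads: even with even is the Jordan product of \<open>R\<close>, even with odd in either
  order is the Jordan action on \<open>M\<close>, and odd with odd is zero, because \<open>M\<close> squares to zero. A map of
  degree 0 preserves the two components, so by additivity it is a pair \<open>(\<delta>, g)\<close>; a map of degree 1
  exchanges them, so it is a pair \<open>(f, \<gamma>)\<close>. Every condition on these four maps is the superderivation
  identity evaluated on one kind of homogeneous pair: two even arguments give that \<open>\<delta>\<close> and \<open>\<gamma>\<close> are
  Jordan derivations, an even and an odd one give the rules for \<open>g\<close> and \<open>f\<close>, and two odd ones give
  the symmetry of \<open>f\<close>. In the even-odd case for \<open>f\<close> the term with \<open>\<gamma>\<close> is a superproduct of two odd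
  elements, hence vanishes. In the odd-odd case the sign \<open>(-1)\<^bsup>|x|\<^esup>\<close> in the degree-1 identity turns the sum
  of the two terms into a difference, which is what makes \<open>f\<close> symmetric.\<close>

section \<open>Additive maps\<close>

lemma additive_map_add:
  assumes "additive_map A B h" "x \<in> carrier A" "y \<in> carrier A"
  shows "h (x \<oplus>\<^bsub>A\<^esub> y) = h x \<oplus>\<^bsub>B\<^esub> h y"
  using assms by (auto simp: additive_map_def hom_def)

lemma additive_map_closed:
  assumes "additive_map A B h" "x \<in> carrier A"
  shows "h x \<in> carrier B"
  using assms by (auto simp: additive_map_def hom_def)

lemma additive_mapI:
  assumes "\<And>x. x \<in> carrier A \<Longrightarrow> h x \<in> carrier B"
    and "\<And>x y. x \<in> carrier A \<Longrightarrow> y \<in> carrier A \<Longrightarrow> h (x \<oplus>\<^bsub>A\<^esub> y) = h x \<oplus>\<^bsub>B\<^esub> h y"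
  shows "additive_map A B h"
  using assms by (auto simp: additive_map_def hom_def)

lemma additive_map_zero:
  assumes "abelian_group A" "abelian_group B" "additive_map A B h"
  shows "h \<zero>\<^bsub>A\<^esub> = \<zero>\<^bsub>B\<^esub>"
proof -
  interpret A: abelian_group A by fact
  interpret B: abelian_group B by fact
  have "h \<zero>\<^bsub>A\<^esub> \<oplus>\<^bsub>B\<^esub> h \<zero>\<^bsub>A\<^esub> = h \<zero>\<^bsub>A\<^esub>"
    using additive_map_add [OF assms(3), of "\<zero>\<^bsub>A\<^esub>" "\<zero>\<^bsub>A\<^esub>"] by simp
  then show ?thesis
    using additive_map_closed [OF assms(3)] B.add.r_cancel_one' by fastforce
qed

lemma (in abelian_group) int_add_pow_neg_one:
  "x \<in> carrier G \<Longrightarrow> [(- 1 :: int)] \<cdot> x = \<ominus> x"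
  by (simp add: add.int_pow_neg add.int_pow_1)

section \<open>Superproducts in the trivial extension\<close>

lemma jordan_act_regular [simp]: "jordan_act (regular_bimodule R) r s = jordan_prod R r s"
  by (simp add: jordan_act_def jordan_prod_def regular_bimodule_def)

lemma regular_bimodule_simps [simp]:
  "carrier (regular_bimodule R) = carrier R"
  "add (regular_bimodule R) = add R"
  by (simp_all add: regular_bimodule_def)

lemma trivial_extension_simps [simp]:
  "carrier (trivial_extension R M) = carrier R \<times> carrier M"
  "\<zero>\<^bsub>trivial_extension R M\<^esub> = (\<zero>\<^bsub>R\<^esub>, \<zero>\<^bsub>M\<^esub>)"
  "(r, m) \<oplus>\<^bsub>trivial_extension R M\<^esub> (r', m') = (r \<oplus>\<^bsub>R\<^esub> r', m \<oplus>\<^bsub>M\<^esub> m')"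
  "(r, m) \<otimes>\<^bsub>trivial_extension R M\<^esub> (r', m') = (r \<otimes>\<^bsub>R\<^esub> r', r \<triangleright>\<^bsub>M\<^esub> m' \<oplus>\<^bsub>M\<^esub> m \<triangleleft>\<^bsub>M\<^esub> r')"
  by (simp_all add: trivial_extension_def)

context bimodule
begin

abbreviation T where "T \<equiv> trivial_extension R M"
abbreviation G where "G \<equiv> trivial_grading R M"

lemma jordan_prod_closed [simp]:
  "r \<in> carrier R \<Longrightarrow> s \<in> carrier R \<Longrightarrow> jordan_prod R r s \<in> carrier R"
  by (simp add: jordan_prod_def)

lemma jordan_prod_comm:
  "r \<in> carrier R \<Longrightarrow> s \<in> carrier R \<Longrightarrow> jordan_prod R r s = jordan_prod R s r"
  by (simp add: jordan_prod_def R.a_comm)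

lemma jordan_act_closed [simp]:
  "r \<in> carrier R \<Longrightarrow> m \<in> carrier M \<Longrightarrow> jordan_act M r m \<in> carrier M"
  by (simp add: jordan_act_def)

lemma jordan_act_zero [simp]:
  "r \<in> carrier R \<Longrightarrow> jordan_act M r \<zero>\<^bsub>M\<^esub> = \<zero>\<^bsub>M\<^esub>"
  "m \<in> carrier M \<Longrightarrow> jordan_act M \<zero>\<^bsub>R\<^esub> m = \<zero>\<^bsub>M\<^esub>"
  by (simp_all add: jordan_act_def)

lemma abelian_group_trivial_extension: "abelian_group T"
  using ring_trivial_extension by (rule ring.is_abelian_group)

lemma neg_trivial_extension:
  assumes "r \<in> carrier R" "m \<in> carrier M"
  shows "\<ominus>\<^bsub>T\<^esub> (r, m) = (\<ominus>\<^bsub>R\<^esub> r, \<ominus>\<^bsub>M\<^esub> m)"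
proof -
  interpret T: abelian_group T
    by (rule abelian_group_trivial_extension)
  show ?thesis
    using assms by (intro T.minus_equality) (simp_all add: R.l_neg M.l_neg)
qed

lemma trivial_extension_int_one:
  assumes "x \<in> carrier T"
  shows "[(1 :: int)] \<cdot>\<^bsub>T\<^esub> x = x"
proof -
  interpret T: abelian_group T
    by (rule abelian_group_trivial_extension)
  show ?thesis
    using assms by (rule T.add.int_pow_1)
qed

lemma parity_even [simp]: "r \<in> carrier R \<Longrightarrow> parity G (r, \<zero>\<^bsub>M\<^esub>) = 0"
  by (simp add: parity_def trivial_grading_def)

lemma parity_odd: "m \<noteq> \<zero>\<^bsub>M\<^esub> \<Longrightarrow> parity G (\<zero>\<^bsub>R\<^esub>, m) = 1"
  by (simp add: parity_def trivial_grading_def)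

lemma superprod_even_even:
  assumes "r \<in> carrier R" "s \<in> carrier R"
  shows "jordan_superprod T G (r, \<zero>\<^bsub>M\<^esub>) (s, \<zero>\<^bsub>M\<^esub>) = (jordan_prod R r s, \<zero>\<^bsub>M\<^esub>)"
  using assms by (simp add: jordan_superprod_def jordan_prod_def trivial_extension_int_one)

lemma superprod_even_odd:
  assumes "r \<in> carrier R" "m \<in> carrier M"
  shows "jordan_superprod T G (r, \<zero>\<^bsub>M\<^esub>) (\<zero>\<^bsub>R\<^esub>, m) = (\<zero>\<^bsub>R\<^esub>, jordan_act M r m)"
  using assms by (simp add: jordan_superprod_def jordan_act_def trivial_extension_int_one)

lemma superprod_odd_even:
  assumes "r \<in> carrier R" "m \<in> carrier M"
  shows "jordan_superprod T G (\<zero>\<^bsub>R\<^esub>, m) (r, \<zero>\<^bsub>M\<^esub>) = (\<zero>\<^bsub>R\<^esub>, jordan_act M r m)"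
  using assms
  by (simp add: jordan_superprod_def jordan_act_def trivial_extension_int_one M.a_comm)

text \<open>Both ring products vanish, and an integer multiple of zero is zero, whatever the sign.\<close>

lemma superprod_odd_odd:
  assumes "m \<in> carrier M" "n \<in> carrier M"
  shows "jordan_superprod T G (\<zero>\<^bsub>R\<^esub>, m) (\<zero>\<^bsub>R\<^esub>, n) = (\<zero>\<^bsub>R\<^esub>, \<zero>\<^bsub>M\<^esub>)"
proof -
  interpret T: abelian_group T
    by (rule abelian_group_trivial_extension)
  have "[k] \<cdot>\<^bsub>T\<^esub> (\<zero>\<^bsub>R\<^esub>, \<zero>\<^bsub>M\<^esub>) = (\<zero>\<^bsub>R\<^esub>, \<zero>\<^bsub>M\<^esub>)" for k :: int
    using T.add.int_pow_one [of k] by simp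
  then show ?thesis
    using assms by (simp add: jordan_superprod_def)
qed

lemmas superprod_homogeneous =
  superprod_even_even superprod_even_odd superprod_odd_even superprod_odd_odd

section \<open>Superderivations of degree 0 and 1\<close>

text \<open>The degree puts \<open>d (r, 0)\<close> in \<open>R\<close> and \<open>d (0, m)\<close> in \<open>M\<close>. The pairs even-even and even-odd
  then give the two product rules.\<close>

lemma jordan_superderivation_of_degree_0_form:
  assumes "jordan_superderivation_of_degree T G 0 d"
  obtains \<delta> g where "jordan_derivation R (regular_bimodule R) \<delta>"
    and "additive_map M M g"
    and "\<And>r m. \<lbrakk>r \<in> carrier R; m \<in> carrier M\<rbrakk> \<Longrightarrow>
      g (jordan_act M r m) = jordan_act M r (g m) \<oplus>\<^bsub>M\<^esub> jordan_act M (\<delta> r) m"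
    and "\<And>r m. \<lbrakk>r \<in> carrier R; m \<in> carrier M\<rbrakk> \<Longrightarrow> d (r, m) = (\<delta> r, g m)"
proof -
  have add: "additive_map T T d"
    and deg: "d ` G 0 \<subseteq> G 0" "d ` G 1 \<subseteq> G 1"
    and der: "\<And>x y. \<lbrakk>x \<in> G 0 \<union> G 1; y \<in> G 0 \<union> G 1\<rbrakk> \<Longrightarrow>
      d (jordan_superprod T G x y) = jordan_superprod T G (d x) y \<oplus>\<^bsub>T\<^esub>
        [(1 :: int)] \<cdot>\<^bsub>T\<^esub> jordan_superprod T G x (d y)"
    using assms by (simp_all add: jordan_superderivation_of_degree_def)
  define \<delta> where "\<delta> r = fst (d (r, \<zero>\<^bsub>M\<^esub>))" for r
  define g where "g m = snd (d (\<zero>\<^bsub>R\<^esub>, m))" for m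
  have d_even: "d (r, \<zero>\<^bsub>M\<^esub>) = (\<delta> r, \<zero>\<^bsub>M\<^esub>)" and \<delta>_closed: "\<delta> r \<in> carrier R"
    if "r \<in> carrier R" for r
    using subsetD [OF deg(1) imageI, of "(r, \<zero>\<^bsub>M\<^esub>)"] that
    by (auto simp: trivial_grading_def \<delta>_def)
  have d_odd: "d (\<zero>\<^bsub>R\<^esub>, m) = (\<zero>\<^bsub>R\<^esub>, g m)" and g_closed: "g m \<in> carrier M"
    if "m \<in> carrier M" for m
    using subsetD [OF deg(2) imageI, of "(\<zero>\<^bsub>R\<^esub>, m)"] that
    by (auto simp: trivial_grading_def g_def)
  have even: "(r, \<zero>\<^bsub>M\<^esub>) \<in> G 0 \<union> G 1" if "r \<in> carrier R" for r
    using that by (simp add: trivial_grading_def)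
  have odd: "(\<zero>\<^bsub>R\<^esub>, m) \<in> G 0 \<union> G 1" if "m \<in> carrier M" for m
    using that by (simp add: trivial_grading_def)
  have \<delta>_add: "\<delta> (r \<oplus>\<^bsub>R\<^esub> s) = \<delta> r \<oplus>\<^bsub>R\<^esub> \<delta> s" if "r \<in> carrier R" "s \<in> carrier R" for r s
    using additive_map_add [OF add, of "(r, \<zero>\<^bsub>M\<^esub>)" "(s, \<zero>\<^bsub>M\<^esub>)"] that by (simp add: d_even)
  have \<delta>_der: "\<delta> (jordan_prod R r s) = jordan_prod R s (\<delta> r) \<oplus>\<^bsub>R\<^esub> jordan_prod R r (\<delta> s)"
    if "r \<in> carrier R" "s \<in> carrier R" for r s
    using der [OF even even, of r s] that
    by (simp add: superprod_homogeneous d_even \<delta>_closed trivial_extension_int_one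
        jordan_prod_comm [of s])
  have g_add: "g (m \<oplus>\<^bsub>M\<^esub> n) = g m \<oplus>\<^bsub>M\<^esub> g n" if "m \<in> carrier M" "n \<in> carrier M" for m n
    using additive_map_add [OF add, of "(\<zero>\<^bsub>R\<^esub>, m)" "(\<zero>\<^bsub>R\<^esub>, n)"] that by (simp add: d_odd)
  show thesis
  proof
    show "jordan_derivation R (regular_bimodule R) \<delta>"
      by (auto simp: jordan_derivation_def \<delta>_closed \<delta>_add \<delta>_der intro: additive_mapI)
    show "additive_map M M g"
      by (auto simp: g_closed g_add intro: additive_mapI)
    fix r m assume rm: "r \<in> carrier R" "m \<in> carrier M"
    show "g (jordan_act M r m) = jordan_act M r (g m) \<oplus>\<^bsub>M\<^esub> jordan_act M (\<delta> r) m"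
      using der [OF even odd, of r m] rm
      by (simp add: superprod_homogeneous d_even d_odd \<delta>_closed g_closed
          trivial_extension_int_one M.a_comm)
    show "d (r, m) = (\<delta> r, g m)"
      using additive_map_add [OF add, of "(r, \<zero>\<^bsub>M\<^esub>)" "(\<zero>\<^bsub>R\<^esub>, m)"] rm
      by (simp add: d_even d_odd \<delta>_closed g_closed)
  qed
qed

text \<open>Here \<open>d (r, 0)\<close> lies in \<open>M\<close> and \<open>d (0, m)\<close> in \<open>R\<close>. For an even-odd pair the contribution of
  \<open>\<gamma>\<close> is odd times odd, hence zero, so \<open>f\<close> commutes with the Jordan action without correction term.
  For an odd-odd pair the left side is \<open>d 0 = 0\<close>, and the sign leaves the difference of the two
  sides of the symmetry condition.\<close>

lemma jordan_superderivation_of_degree_1_form: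
  assumes "jordan_superderivation_of_degree T G 1 d"
  obtains \<gamma> f where "jordan_derivation R M \<gamma>"
    and "jordan_bimodule_hom R M (regular_bimodule R) f"
    and "\<And>m n. \<lbrakk>m \<in> carrier M; n \<in> carrier M\<rbrakk> \<Longrightarrow> jordan_act M (f n) m = jordan_act M (f m) n"
    and "\<And>r m. \<lbrakk>r \<in> carrier R; m \<in> carrier M\<rbrakk> \<Longrightarrow> d (r, m) = (f m, \<gamma> r)"
proof -
  interpret T: abelian_group T
    by (rule abelian_group_trivial_extension)
  have add: "additive_map T T d"
    and deg: "d ` G 0 \<subseteq> G 1" "d ` G 1 \<subseteq> G 0"
    and der: "\<And>x y. \<lbrakk>x \<in> G 0 \<union> G 1; y \<in> G 0 \<union> G 1\<rbrakk> \<Longrightarrow>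
      d (jordan_superprod T G x y) = jordan_superprod T G (d x) y \<oplus>\<^bsub>T\<^esub>
        [((- 1) ^ parity G x :: int)] \<cdot>\<^bsub>T\<^esub> jordan_superprod T G x (d y)"
    using assms by (simp_all add: jordan_superderivation_of_degree_def)
  define \<gamma> where "\<gamma> r = snd (d (r, \<zero>\<^bsub>M\<^esub>))" for r
  define f where "f m = fst (d (\<zero>\<^bsub>R\<^esub>, m))" for m
  have d_even: "d (r, \<zero>\<^bsub>M\<^esub>) = (\<zero>\<^bsub>R\<^esub>, \<gamma> r)" and \<gamma>_closed: "\<gamma> r \<in> carrier M"
    if "r \<in> carrier R" for r
    using subsetD [OF deg(1) imageI, of "(r, \<zero>\<^bsub>M\<^esub>)"] that
    by (auto simp: trivial_grading_def \<gamma>_def)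
  have d_odd: "d (\<zero>\<^bsub>R\<^esub>, m) = (f m, \<zero>\<^bsub>M\<^esub>)" and f_closed: "f m \<in> carrier R"
    if "m \<in> carrier M" for m
    using subsetD [OF deg(2) imageI, of "(\<zero>\<^bsub>R\<^esub>, m)"] that
    by (auto simp: trivial_grading_def f_def)
  have even: "(r, \<zero>\<^bsub>M\<^esub>) \<in> G 0 \<union> G 1" if "r \<in> carrier R" for r
    using that by (simp add: trivial_grading_def)
  have odd: "(\<zero>\<^bsub>R\<^esub>, m) \<in> G 0 \<union> G 1" if "m \<in> carrier M" for m
    using that by (simp add: trivial_grading_def)
  have d_zero: "d (\<zero>\<^bsub>R\<^esub>, \<zero>\<^bsub>M\<^esub>) = (\<zero>\<^bsub>R\<^esub>, \<zero>\<^bsub>M\<^esub>)"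
    using additive_map_zero [OF T.abelian_group_axioms T.abelian_group_axioms add] by simp
  then have f_zero: "f \<zero>\<^bsub>M\<^esub> = \<zero>\<^bsub>R\<^esub>"
    by (simp add: f_def)
  have \<gamma>_add: "\<gamma> (r \<oplus>\<^bsub>R\<^esub> s) = \<gamma> r \<oplus>\<^bsub>M\<^esub> \<gamma> s" if "r \<in> carrier R" "s \<in> carrier R" for r s
    using additive_map_add [OF add, of "(r, \<zero>\<^bsub>M\<^esub>)" "(s, \<zero>\<^bsub>M\<^esub>)"] that by (simp add: d_even)
  have \<gamma>_der: "\<gamma> (jordan_prod R r s) = jordan_act M s (\<gamma> r) \<oplus>\<^bsub>M\<^esub> jordan_act M r (\<gamma> s)"
    if "r \<in> carrier R" "s \<in> carrier R" for r s
    using der [OF even even, of r s] that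
    by (simp add: superprod_homogeneous d_even \<gamma>_closed trivial_extension_int_one)
  have f_add: "f (m \<oplus>\<^bsub>M\<^esub> n) = f m \<oplus>\<^bsub>R\<^esub> f n" if "m \<in> carrier M" "n \<in> carrier M" for m n
    using additive_map_add [OF add, of "(\<zero>\<^bsub>R\<^esub>, m)" "(\<zero>\<^bsub>R\<^esub>, n)"] that by (simp add: d_odd)
  have f_act: "f (jordan_act M r m) = jordan_prod R r (f m)"
    if "r \<in> carrier R" "m \<in> carrier M" for r m
    using der [OF even odd, of r m] that
    by (simp add: superprod_homogeneous d_even d_odd \<gamma>_closed f_closed trivial_extension_int_one)
  have f_sym: "jordan_act M (f n) m = jordan_act M (f m) n"
    if "m \<in> carrier M" "n \<in> carrier M" for m n
  proof (cases "m = \<zero>\<^bsub>M\<^esub>")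
    \<comment> \<open>The zero element counts as even, so its sign is \<open>+1\<close>; here both sides vanish.\<close>
    case True
    then show ?thesis
      using that by (simp add: f_closed f_zero)
  next
    case False
    let ?a = "jordan_act M (f m) n" and ?b = "jordan_act M (f n) m"
    have "(\<zero>\<^bsub>R\<^esub>, \<zero>\<^bsub>M\<^esub>) = (\<zero>\<^bsub>R\<^esub>, ?a) \<oplus>\<^bsub>T\<^esub> [(- 1 :: int)] \<cdot>\<^bsub>T\<^esub> (\<zero>\<^bsub>R\<^esub>, ?b)"
      using der [OF odd odd, of m n] that False
      by (simp add: superprod_homogeneous d_odd d_zero f_closed parity_odd)
    also have "\<dots> = (\<zero>\<^bsub>R\<^esub>, ?a \<ominus>\<^bsub>M\<^esub> ?b)"
      using that f_closed
      by (simp add: T.int_add_pow_neg_one neg_trivial_extension M.minus_eq)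
    finally have "?a \<ominus>\<^bsub>M\<^esub> ?b = \<zero>\<^bsub>M\<^esub>"
      by simp
    then show ?thesis
      using that f_closed M.minus_equality [of ?a "\<ominus>\<^bsub>M\<^esub> ?b"]
      by (simp add: M.minus_eq)
  qed
  show thesis
  proof
    show "jordan_derivation R M \<gamma>"
      by (auto simp: jordan_derivation_def \<gamma>_closed \<gamma>_add \<gamma>_der intro: additive_mapI)
    show "jordan_bimodule_hom R M (regular_bimodule R) f"
      by (auto simp: jordan_bimodule_hom_def f_closed f_add f_act intro: additive_mapI)
    fix r m assume rm: "r \<in> carrier R" "m \<in> carrier M"
    show "d (r, m) = (f m, \<gamma> r)"
      using additive_map_add [OF add, of "(r, \<zero>\<^bsub>M\<^esub>)" "(\<zero>\<^bsub>R\<^esub>, m)"] rm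
      by (simp add: d_even d_odd \<gamma>_closed f_closed)
  qed (fact f_sym)
qed

end

theorem theorem2p1:
  fixes R :: "('a, 'c) ring_scheme"
    and M :: "('a, 'b, 'd) bimodule_scheme"
  assumes "ring R" and "bimodule R M"
  shows
    "(\<forall>d\<^sub>0 d\<^sub>1.
        jordan_superderivation_of_degree (trivial_extension R M) (trivial_grading R M) 0 d\<^sub>0 \<longrightarrow>
        jordan_superderivation_of_degree (trivial_extension R M) (trivial_grading R M) 1 d\<^sub>1 \<longrightarrow>
        (\<exists>\<delta> \<gamma> f g.
           jordan_derivation R (regular_bimodule R) \<delta> \<and>
           jordan_derivation R M \<gamma> \<and>
           jordan_bimodule_hom R M (regular_bimodule R) f \<and>
           (\<forall>m\<in>carrier M. \<forall>m'\<in>carrier M. jordan_act M (f m') m = jordan_act M (f m) m') \<and>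
           additive_map M M g \<and>
           (\<forall>r\<in>carrier R. \<forall>m\<in>carrier M.
              g (jordan_act M r m) = jordan_act M r (g m) \<oplus>\<^bsub>M\<^esub> jordan_act M (\<delta> r) m) \<and>
           (\<forall>r\<in>carrier R. \<forall>m\<in>carrier M. d\<^sub>0 (r, m) = (\<delta> r, g m) \<and> d\<^sub>1 (r, m) = (f m, \<gamma> r))))
     \<and>
     (\<forall>d. jordan_superderivation (trivial_extension R M) (trivial_grading R M) d \<longrightarrow>
        (\<exists>\<delta> \<gamma> f g.
           jordan_derivation R (regular_bimodule R) \<delta> \<and>
           jordan_derivation R M \<gamma> \<and>
           jordan_bimodule_hom R M (regular_bimodule R) f \<and>
           (\<forall>m\<in>carrier M. \<forall>m'\<in>carrier M. jordan_act M (f m') m = jordan_act M (f m) m') \<and>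
           additive_map M M g \<and>
           (\<forall>r\<in>carrier R. \<forall>m\<in>carrier M.
              g (jordan_act M r m) = jordan_act M r (g m) \<oplus>\<^bsub>M\<^esub> jordan_act M (\<delta> r) m) \<and>
           (\<forall>r\<in>carrier R. \<forall>m\<in>carrier M.
              d (r, m) = (\<delta> r \<oplus>\<^bsub>R\<^esub> f m, g m \<oplus>\<^bsub>M\<^esub> \<gamma> r))))"
proof -
  interpret bimodule R M by fact
  let ?T = "trivial_extension R M" and ?G = "trivial_grading R M"
  let ?P = "\<lambda>\<delta> \<gamma> f g.
    jordan_derivation R (regular_bimodule R) \<delta> \<and>
    jordan_derivation R M \<gamma> \<and>
    jordan_bimodule_hom R M (regular_bimodule R) f \<and>
    (\<forall>m\<in>carrier M. \<forall>m'\<in>carrier M. jordan_act M (f m') m = jordan_act M (f m) m') \<and>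
    additive_map M M g \<and>
    (\<forall>r\<in>carrier R. \<forall>m\<in>carrier M.
       g (jordan_act M r m) = jordan_act M r (g m) \<oplus>\<^bsub>M\<^esub> jordan_act M (\<delta> r) m)"
  have components: "\<exists>\<delta> \<gamma> f g. ?P \<delta> \<gamma> f g \<and>
      (\<forall>r\<in>carrier R. \<forall>m\<in>carrier M. d\<^sub>0 (r, m) = (\<delta> r, g m) \<and> d\<^sub>1 (r, m) = (f m, \<gamma> r))"
    if d0: "jordan_superderivation_of_degree ?T ?G 0 d\<^sub>0"
      and d1: "jordan_superderivation_of_degree ?T ?G 1 d\<^sub>1" for d\<^sub>0 d\<^sub>1
  proof -
    obtain \<delta> g where "jordan_derivation R (regular_bimodule R) \<delta>" "additive_map M M g"
      "\<And>r m. \<lbrakk>r \<in> carrier R; m \<in> carrier M\<rbrakk> \<Longrightarrow>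
        g (jordan_act M r m) = jordan_act M r (g m) \<oplus>\<^bsub>M\<^esub> jordan_act M (\<delta> r) m"
      "\<And>r m. \<lbrakk>r \<in> carrier R; m \<in> carrier M\<rbrakk> \<Longrightarrow> d\<^sub>0 (r, m) = (\<delta> r, g m)"
      using jordan_superderivation_of_degree_0_form [OF d0] by blast
    moreover obtain \<gamma> f where "jordan_derivation R M \<gamma>"
      "jordan_bimodule_hom R M (regular_bimodule R) f"
      "\<And>m n. \<lbrakk>m \<in> carrier M; n \<in> carrier M\<rbrakk> \<Longrightarrow> jordan_act M (f n) m = jordan_act M (f m) n"
      "\<And>r m. \<lbrakk>r \<in> carrier R; m \<in> carrier M\<rbrakk> \<Longrightarrow> d\<^sub>1 (r, m) = (f m, \<gamma> r)"
      using jordan_superderivation_of_degree_1_form [OF d1] by blast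
    ultimately have "?P \<delta> \<gamma> f g \<and>
        (\<forall>r\<in>carrier R. \<forall>m\<in>carrier M. d\<^sub>0 (r, m) = (\<delta> r, g m) \<and> d\<^sub>1 (r, m) = (f m, \<gamma> r))"
      by simp
    then show ?thesis
      by blast
  qed
  have sum: "\<exists>\<delta> \<gamma> f g. ?P \<delta> \<gamma> f g \<and>
      (\<forall>r\<in>carrier R. \<forall>m\<in>carrier M. d (r, m) = (\<delta> r \<oplus>\<^bsub>R\<^esub> f m, g m \<oplus>\<^bsub>M\<^esub> \<gamma> r))"
    if "jordan_superderivation ?T ?G d" for d
  proof -
    from that obtain d\<^sub>0 d\<^sub>1
      where "jordan_superderivation_of_degree ?T ?G 0 d\<^sub>0"
        and "jordan_superderivation_of_degree ?T ?G 1 d\<^sub>1"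
        and d: "\<forall>x\<in>carrier ?T. d x = d\<^sub>0 x \<oplus>\<^bsub>?T\<^esub> d\<^sub>1 x"
      unfolding jordan_superderivation_def by blast
    then obtain \<delta> \<gamma> f g where P: "?P \<delta> \<gamma> f g"
      and "\<forall>r\<in>carrier R. \<forall>m\<in>carrier M. d\<^sub>0 (r, m) = (\<delta> r, g m) \<and> d\<^sub>1 (r, m) = (f m, \<gamma> r)"
      using components by blast
    with d have "\<forall>r\<in>carrier R. \<forall>m\<in>carrier M. d (r, m) = (\<delta> r \<oplus>\<^bsub>R\<^esub> f m, g m \<oplus>\<^bsub>M\<^esub> \<gamma> r)"
      by simp
    with P show ?thesis
      by blast
  qed
  show ?thesis
    using components sum by (simp only: conj_assoc) blast
qed

end
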